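(* Let $d_w>2$ and let $(X,d,\mu)$ be a compact metric measure space with $\mu$ a positive doubling Radon measure, let $0<Q<\infty$ be an exponent such that for some constant $C>0$, $\frac{\mu(B(x,R))}{\mu(B(x,r))}\le C\left(\frac{R}{r}\right)^Q$ for all $x\in X$ and $0<r\le R$, and assume the 2-Poincaré inequality with Korevaar–Schoen energies (P) stated in the context. Assume $0<Q\le d_w$. Then any sequence $\{f_n\}_{n\ge1}\subset KS^{d_w/2,2}(X)$ such that $$\sup_{n\ge1}\Big(\|f_n\|_{L^2(X,\mu)}+\liminf_{r\to0^+}E_{d_w/2,X}(f_n,r)\Big)<+\infty$$ contains a subsequence that converges in $L^\alpha(X,\mu)$ for any $1\le\alpha<\infty$.
   Context: $B(x,r)$ denotes the open ball. Positive and doubling: there is $C>0$ with $0<\mu(B(x,2r))\le C\mu(B(x,r))<\infty$ for all $x\in X$, $r>0$ (this implies that an exponent $Q$ as in the statement exists). For a Borel set $U\subseteq X$, $r>0$ and $f\in L^2(X,\mu)$, $$E_{d_w/2,U}(f,r):=\int_U\frac{1}{\mu(B(x,r))}\int_{B(x,r)}\frac{|f(y)-f(x)|^2}{r^{d_w}}\,d\mu(y)\,d\mu(x),$$ and $KS^{d_w/2,2}(X)=\{f\in L^2(X,\mu):\limsup_{r\to0^+}E_{d_w/2,X}(f,r)<+\infty\}$. (P) There are $C>0$, $\lambda\ge1$ such that for all $f\in KS^{d_w/2,2}(X)$, $x\in X$, $R>0$: $\int_{B(x,R)}|f(y)-f_{B(x,R)}|^2d\mu(y)\le CR^{d_w}\liminf_{r\to0^+}E_{d_w/2,B(x,\lambda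 R)}(f,r)$, where $f_{B(x,R)}=\frac{1}{\mu(B(x,R))}\int_{B(x,R)}f\,d\mu$. *)

theory Defs
  imports "HOL-Analysis.Analysis"
begin

text \<open>The space \<open>X\<close> is a type of class \<^class>\<open>metric_space\<close>; elements of \<open>L\<^sup>p\<close> are represented by
  real-valued functions rather than by classes modulo almost-everywhere equality.\<close>

definition radon_measure :: "'a::metric_space measure \<Rightarrow> bool" where
  "radon_measure M \<longleftrightarrow>
     sets M = sets borel \<and>
     (\<forall>K. compact K \<longrightarrow> emeasure M K < \<infinity>) \<and>
     (\<forall>B\<in>sets borel. emeasure M B = (SUP K\<in>{K. K \<subseteq> B \<and> compact K}. emeasure M K))"

definition positive_doubling :: "'a::metric_space measure \<Rightarrow> bool" where
  "positive_doubling M \<longleftrightarrow>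
     (\<exists>C>0. \<forall>x. \<forall>r>0.
        0 < emeasure M (ball x (2 * r)) \<and>
        emeasure M (ball x (2 * r)) \<le> ennreal C * emeasure M (ball x r) \<and>
        ennreal C * emeasure M (ball x r) < \<infinity>)"

definition volume_growth_exponent :: "'a::metric_space measure \<Rightarrow> real \<Rightarrow> bool" where
  "volume_growth_exponent M Q \<longleftrightarrow>
     (\<exists>C>0. \<forall>x r R. 0 < r \<and> r \<le> R \<longrightarrow>
        measure M (ball x R) / measure M (ball x r) \<le> C * (R / r) powr Q)"

definition Lp :: "real \<Rightarrow> 'a measure \<Rightarrow> ('a \<Rightarrow> real) set" where
  "Lp p M = {f \<in> borel_measurable M. integrable M (\<lambda>x. \<bar>f x\<bar> powr p)}"

definition Lp_norm :: "real \<Rightarrow> 'a measure \<Rightarrow> ('a \<Rightarrow> real) \<Rightarrow> real" where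
  "Lp_norm p M f = (\<integral>x. \<bar>f x\<bar> powr p \<partial>M) powr (1 / p)"

definition KS_energy ::
  "'a::metric_space measure \<Rightarrow> real \<Rightarrow> 'a set \<Rightarrow> ('a \<Rightarrow> real) \<Rightarrow> real \<Rightarrow> ennreal" where
  "KS_energy M dw U f r =
     (\<integral>\<^sup>+x\<in>U. 1 / emeasure M (ball x r) *
        (\<integral>\<^sup>+y\<in>ball x r. ennreal (\<bar>f y - f x\<bar>\<^sup>2 / r powr dw) \<partial>M) \<partial>M)"

text \<open>\<open>KS M dw\<close> is the Korevaar--Schoen space usually written \<open>KS\<^bsup>dw/2,2\<^esup>(X)\<close>:
  the parameter is \<open>dw\<close>, not the smoothness order \<open>dw / 2\<close>.\<close>

definition KS :: "'a::metric_space measure \<Rightarrow> real \<Rightarrow> ('a \<Rightarrow> real) set" where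
  "KS M dw = {f \<in> Lp 2 M. Limsup (at_right 0) (KS_energy M dw UNIV f) < \<infinity>}"

definition ball_average :: "'a::metric_space measure \<Rightarrow> ('a \<Rightarrow> real) \<Rightarrow> 'a \<Rightarrow> real \<Rightarrow> real" where
  "ball_average M f x R = 1 / measure M (ball x R) * (LINT y:ball x R|M. f y)"

definition KS_Poincare :: "'a::metric_space measure \<Rightarrow> real \<Rightarrow> bool" where
  "KS_Poincare M dw \<longleftrightarrow>
     (\<exists>C>0. \<exists>L\<ge>1. \<forall>f\<in>KS M dw. \<forall>x. \<forall>R>0.
        (\<integral>\<^sup>+y\<in>ball x R. ennreal (\<bar>f y - ball_average M f x R\<bar>\<^sup>2) \<partial>M)
          \<le> ennreal (C * R powr dw) *
             Liminf (at_right 0) (KS_energy M dw (ball x (L * R)) f))"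

definition converges_in_Lp ::
  "real \<Rightarrow> 'a measure \<Rightarrow> (nat \<Rightarrow> 'a \<Rightarrow> real) \<Rightarrow> ('a \<Rightarrow> real) \<Rightarrow> bool" where
  "converges_in_Lp p M f g \<longleftrightarrow>
     (\<forall>n. f n \<in> Lp p M) \<and> g \<in> Lp p M \<and>
     (\<lambda>n. Lp_norm p M (\<lambda>x. f n x - g x)) \<longlonglongrightarrow> 0"

end

theory Submission
  imports Defs "HOL-Complex_Analysis.Great_Picard" "HOL-Real_Asymp.Real_Asymp"
begin

text \<open>
  Since \<open>Q \<le> dw\<close>, volume growth gives \<open>\<mu>(B(x,R)) \<ge> c R\<^sup>d\<^sup>w\<close>, so (P) bounds the change of the average of
  \<open>f\<^sub>n\<close> from \<open>B(x,2R)\<close> to \<open>B(x,R)\<close> uniformly; averages over balls of radius \<open>R\<^sub>k = D/2\<^sup>k\<close> are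
  therefore at most \<open>b + k m\<close>. Covering \<open>X\<close> by balls of radius \<open>R\<^sub>k\<close> with bounded overlap and summing (P), the
  \<open>L\<^sup>2\<close> distance of \<open>f\<^sub>n\<close> from its averages at scale \<open>k\<close> decays geometrically in \<open>k\<close>. Two consequences: by
  Chebyshev \<open>\<mu>(|f\<^sub>n| > b + 1 + k m)\<close> decays geometrically, so all moments are uniformly bounded
  (no John--Nirenberg lemma is needed); and a diagonal subsequence along which all averages converge is
  Cauchy in \<open>L\<^sup>2\<close>. Boundedness of all moments upgrades this to convergence in every \<open>L\<^sup>\<alpha>\<close>.
\<close>

section \<open>Lower integrals and lower limits\<close>

text \<open>Nothing is assumed measurable here: \<^const>\<open>nn_integral\<close> is then a lower integral, which is still
  superadditive. This avoids measurability of the density of the Korevaar--Schoen energy.\<close>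

lemma nn_integral_add_le:
  "(\<integral>\<^sup>+x. f x \<partial>M) + (\<integral>\<^sup>+x. g x \<partial>M) \<le> (\<integral>\<^sup>+x. f x + g x \<partial>M)"
proof -
  have *: "integral\<^sup>S M s + integral\<^sup>S M t \<le> (\<integral>\<^sup>+x. f x + g x \<partial>M)"
    if "simple_function M s" "s \<le> f" "simple_function M t" "t \<le> g" for s t
  proof -
    have "integral\<^sup>S M s + integral\<^sup>S M t = (\<integral>\<^sup>+x. s x + t x \<partial>M)"
      using that by (simp add: nn_integral_add borel_measurable_simple_function
          flip: nn_integral_eq_simple_integral)
    also have "\<dots> \<le> (\<integral>\<^sup>+x. f x + g x \<partial>M)"
      using that by (intro nn_integral_mono add_mono) (auto simp: le_fun_def)
    finally show ?thesis .
  qed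
  \<comment> \<open>In \<open>ennreal\<close> a supremum may be pulled through the addition of a
    fixed term only over a nonempty index set; the zero function provides a member.\<close>
  have ne: "{g. simple_function M g \<and> g \<le> h} \<noteq> {}" for h :: "'a \<Rightarrow> ennreal"
    by (auto intro!: exI[of _ "\<lambda>_. 0"] simp: le_fun_def)
  show ?thesis
    unfolding nn_integral_def[of M f] nn_integral_def[of M g]
    by (subst ennreal_SUP_add_left[OF ne, symmetric], rule SUP_least,
        subst ennreal_SUP_add_right[OF ne], rule SUP_least) (use * in auto)
qed

lemma nn_integral_sum_le:
  assumes "finite I"
  shows "(\<Sum>i\<in>I. \<integral>\<^sup>+x. f i x \<partial>M) \<le> (\<integral>\<^sup>+x. (\<Sum>i\<in>I. f i x) \<partial>M)"
  using assms
proof (induction I)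
  case (insert i I)
  then have "(\<Sum>i\<in>insert i I. \<integral>\<^sup>+x. f i x \<partial>M) \<le> (\<integral>\<^sup>+x. f i x \<partial>M) + (\<integral>\<^sup>+x. (\<Sum>i\<in>I. f i x) \<partial>M)"
    by (simp add: add_left_mono)
  also have "\<dots> \<le> (\<integral>\<^sup>+x. f i x + (\<Sum>i\<in>I. f i x) \<partial>M)"
    by (rule nn_integral_add_le)
  finally show ?case
    using insert by simp
qed simp

text \<open>For \<open>c\<close> positive and finite, dividing by \<open>c\<close> turns a simple
  function below \<open>c f\<close> into one below \<open>f\<close>. The supremum defining the lower
  integral therefore scales without any measurability of \<open>f\<close>.\<close>

lemma nn_integral_cmult_le:
  assumes "c > 0"
  shows "(\<integral>\<^sup>+x. ennreal c * f x \<partial>M) \<le> ennreal c * (\<integral>\<^sup>+x. f x \<partial>M)"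
proof (subst nn_integral_def, rule SUP_least, clarify)
  fix s assume s: "simple_function M s" "s \<le> (\<lambda>x. ennreal c * f x)"
  have c: "ennreal c * (ennreal (1 / c) * y) = y" for y
    using assms by (simp flip: mult.assoc ennreal_mult)
  have c': "ennreal (1 / c) * (ennreal c * y) = y" for y
    using assms by (simp flip: mult.assoc ennreal_mult)
  have "integral\<^sup>S M s = (\<integral>\<^sup>+x. ennreal c * (ennreal (1 / c) * s x) \<partial>M)"
    using s by (simp only: c nn_integral_eq_simple_integral)
  also have "\<dots> = ennreal c * (\<integral>\<^sup>+x. ennreal (1 / c) * s x \<partial>M)"
    using s(1) by (intro nn_integral_cmult borel_measurable_simple_function) auto
  also have "\<dots> \<le> ennreal c * (\<integral>\<^sup>+x. f x \<partial>M)"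
  proof (intro mult_left_mono nn_integral_mono)
    fix x
    have "ennreal (1 / c) * s x \<le> ennreal (1 / c) * (ennreal c * f x)"
      using s(2) by (intro mult_left_mono) (auto simp: le_fun_def)
    then show "ennreal (1 / c) * s x \<le> f x"
      by (simp only: c')
  qed auto
  finally show "integral\<^sup>S M s \<le> ennreal c * (\<integral>\<^sup>+x. f x \<partial>M)" .
qed

text \<open>A lower limit is a supremum over eventual properties \<open>P\<close> of infima over
  \<open>P\<close>. The family is directed, since the conjunction of two eventual properties makes
  both infima larger, so the sum of the two suprema is a supremum over one common
  \<open>P\<close>.\<close>

lemma Liminf_add_le_ennreal:
  fixes f g :: "_ \<Rightarrow> ennreal"
  shows "Liminf F f + Liminf F g \<le> Liminf F (\<lambda>x. f x + g x)"
proof -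
  have "Liminf F f + Liminf F g =
      (SUP P\<in>{P. eventually P F}. (INF x\<in>Collect P. f x) + (INF x\<in>Collect P. g x))"
    unfolding Liminf_def
  proof (rule SUP_add_directed_ennreal[symmetric], goal_cases)
    case (1 P P')
    then show ?case
      by (intro bexI[of _ "\<lambda>x. P x \<and> P' x"] add_mono INF_superset_mono)
        (auto intro: eventually_conj)
  qed
  also have "\<dots> \<le> Liminf F (\<lambda>x. f x + g x)"
    unfolding Liminf_def
    by (intro SUP_mono bexI, rule INF_greatest) (auto intro: add_mono INF_lower)
  finally show ?thesis .
qed

lemma Liminf_sum_le_ennreal:
  fixes f :: "_ \<Rightarrow> _ \<Rightarrow> ennreal"
  assumes "finite I"
  shows "(\<Sum>i\<in>I. Liminf F (f i)) \<le> Liminf F (\<lambda>x. \<Sum>i\<in>I. f i x)"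
  using assms
proof (induction I)
  case (insert i I)
  then have "(\<Sum>i\<in>insert i I. Liminf F (f i)) \<le> Liminf F (f i) + Liminf F (\<lambda>x. \<Sum>i\<in>I. f i x)"
    by (simp add: add_left_mono)
  also have "\<dots> \<le> Liminf F (\<lambda>x. f i x + (\<Sum>i\<in>I. f i x))"
    by (rule Liminf_add_le_ennreal)
  finally show ?case
    using insert by simp
qed simp

text \<open>Multiplication by a finite constant is monotone and continuous. Over the trivial filter
  every lower limit is infinite, and the identity would break down for a vanishing constant.\<close>

lemma Liminf_cmult_ennreal:
  fixes f :: "_ \<Rightarrow> ennreal"
  assumes "F \<noteq> bot"
  shows "Liminf F (\<lambda>x. ennreal c * f x) = ennreal c * Liminf F f"
  using assms
  by (intro Liminf_compose_continuous_mono monoI mult_left_mono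
      ennreal_continuous_on_cmult continuous_intros) auto

section \<open>Exponential tails and convergence in \<open>L\<^sup>p\<close>\<close>

text \<open>Chebyshev's inequality with a local centre: a point where \<open>h\<close> exceeds
  \<open>m + 1\<close> in modulus lies in some \<open>B i\<close>, and there \<open>h\<close>
  differs from \<open>a i\<close> by more than 1, so the sum of the local squares is at least
  1.\<close>

lemma emeasure_tail_le:
  assumes [measurable]: "h \<in> borel_measurable M" "\<And>i. i \<in> I \<Longrightarrow> B i \<in> sets M"
    and fin: "finite I" and cov: "space M \<subseteq> (\<Union>i\<in>I. B i)"
    and a: "\<And>i. i \<in> I \<Longrightarrow> \<bar>a i\<bar> \<le> m"
    and c: "(\<Sum>i\<in>I. \<integral>\<^sup>+x\<in>B i. ennreal ((h x - a i)\<^sup>2) \<partial>M) \<le> c"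
  shows "emeasure M {x \<in> space M. \<bar>h x\<bar> > m + 1} \<le> c"
proof -
  have "emeasure M {x \<in> space M. \<bar>h x\<bar> > m + 1} =
      (\<integral>\<^sup>+x. indicator {x \<in> space M. \<bar>h x\<bar> > m + 1} x \<partial>M)"
    by simp
  also have "\<dots> \<le> (\<integral>\<^sup>+x. (\<Sum>i\<in>I. ennreal ((h x - a i)\<^sup>2) * indicator (B i) x) \<partial>M)"
  proof (rule nn_integral_mono)
    fix x assume x: "x \<in> space M"
    then obtain i where i: "i \<in> I" "x \<in> B i" using cov by auto
    show "indicator {x \<in> space M. \<bar>h x\<bar> > m + 1} x
        \<le> (\<Sum>i\<in>I. ennreal ((h x - a i)\<^sup>2) * indicator (B i) x)"
    proof (cases "\<bar>h x\<bar> > m + 1")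
      case True
      then have "1 < \<bar>h x - a i\<bar>" using a[OF i(1)] by linarith
      then have "1 \<le> (h x - a i)\<^sup>2"
        using abs_le_square_iff[of 1 "h x - a i"] by simp
      then have "1 \<le> ennreal ((h x - a i)\<^sup>2) * indicator (B i) x" using i by simp
      also have "\<dots> \<le> (\<Sum>i\<in>I. ennreal ((h x - a i)\<^sup>2) * indicator (B i) x)"
        using i fin by (intro member_le_sum) auto
      finally show ?thesis using True x by simp
    qed simp
  qed
  also have "\<dots> = (\<Sum>i\<in>I. \<integral>\<^sup>+x\<in>B i. ennreal ((h x - a i)\<^sup>2) \<partial>M)"
    by (intro nn_integral_sum) measurable
  also note c
  finally show ?thesis .
qed

text \<open>A discrete layer-cake bound with levels \<open>b + k m\<close>: a point between levels
  \<open>k\<close> and \<open>Suc k\<close> is counted by the tail at the lower level and weighted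
  by the power of the upper one.\<close>

lemma nn_integral_powr_le_suminf_tails:
  fixes b m p :: real
  assumes [measurable]: "h \<in> borel_measurable M"
    and "m > 0" "p \<ge> 0"
    and tail: "\<And>k. emeasure M {x \<in> space M. \<bar>h x\<bar> > b + real k * m} \<le> ennreal (t k)"
    and t: "\<And>k. t k \<ge> 0"
  shows "(\<integral>\<^sup>+x. ennreal (\<bar>h x\<bar> powr p) \<partial>M)
    \<le> ennreal (b powr p) * emeasure M (space M) + (\<Sum>k. ennreal ((b + real (Suc k) * m) powr p * t k))"
proof -
  define T where "T k = {x \<in> space M. \<bar>h x\<bar> > b + real k * m}" for k
  have [measurable]: "T k \<in> sets M" for k unfolding T_def by measurable
  let ?c = "\<lambda>k. ennreal ((b + real (Suc k) * m) powr p)"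
  have "(\<integral>\<^sup>+x. ennreal (\<bar>h x\<bar> powr p) \<partial>M)
      \<le> (\<integral>\<^sup>+x. ennreal (b powr p) + (\<Sum>k. ?c k * indicator (T k) x) \<partial>M)"
  proof (rule nn_integral_mono)
    fix x assume x: "x \<in> space M"
    show "ennreal (\<bar>h x\<bar> powr p) \<le> ennreal (b powr p) + (\<Sum>k. ?c k * indicator (T k) x)"
    proof (cases "\<bar>h x\<bar> \<le> b")
      case True
      then have "\<bar>h x\<bar> powr p \<le> b powr p" using \<open>p \<ge> 0\<close> by (intro powr_mono2) auto
      then show ?thesis by (meson add_increasing2 ennreal_leI zero_le)
    next
      case False
      obtain n where n: "\<bar>h x\<bar> - b \<le> real n * m"
        using reals_Archimedean3[OF \<open>m > 0\<close>] by (meson less_eq_real_def)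
      \<comment> \<open>The least level not below the value cannot be level 0, because the value
        exceeds \<open>b\<close>. Its predecessor \<open>k\<close> then puts the point into
        \<open>T k\<close>, while level \<open>Suc k\<close> still bounds the value.\<close>
      define l where "l = (LEAST n. \<bar>h x\<bar> - b \<le> real n * m)"
      have l: "\<bar>h x\<bar> - b \<le> real l * m" unfolding l_def by (rule LeastI) (rule n)
      with False have "l \<noteq> 0" by (intro notI) auto
      then obtain k where k: "l = Suc k" by (cases l) auto
      then have "\<not> \<bar>h x\<bar> - b \<le> real k * m"
        unfolding l_def by (intro not_less_Least) simp
      then have "x \<in> T k" using x by (auto simp: T_def)
      have "ennreal (\<bar>h x\<bar> powr p) \<le> ?c k"
        using l k \<open>p \<ge> 0\<close> by (intro ennreal_leI powr_mono2) auto
      also have "\<dots> = ?c k * indicator (T k) x" using \<open>x \<in> T k\<close> by simp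
      also have "\<dots> \<le> (\<Sum>k. ?c k * indicator (T k) x)"
      proof -
        have "u k \<le> suminf u" for u :: "nat \<Rightarrow> ennreal"
          using sum_le_suminf[of u "{k}"] by simp
        then show ?thesis .
      qed
      finally show ?thesis by (simp add: add_increasing)
    qed
  qed
  also have "\<dots> = ennreal (b powr p) * emeasure M (space M) + (\<Sum>k. ?c k * emeasure M (T k))"
    by (subst nn_integral_add) (simp_all add: nn_integral_suminf nn_integral_cmult_indicator)
  also have "\<dots> \<le> ennreal (b powr p) * emeasure M (space M)
      + (\<Sum>k. ennreal ((b + real (Suc k) * m) powr p * t k))"
  proof (intro add_left_mono suminf_le)
    show "?c k * emeasure M (T k) \<le> ennreal ((b + real (Suc k) * m) powr p * t k)" for k
      unfolding ennreal_mult[OF powr_ge_zero t] T_def by (intro mult_left_mono tail) auto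
  qed auto
  finally show ?thesis .
qed

lemma summable_powr_times_exp:
  fixes b m p c :: real
  assumes "m > 0" "c > 0"
  shows "summable (\<lambda>k. (b + real (Suc k) * m) powr p * (K * exp (- c * real k)))"
proof (rule summable_comparison_test_bigo)
  show "summable (\<lambda>k. norm (1 / real k ^ 2))"
    using inverse_power_summable[of 2, where 'a = real] by (simp add: field_simps)
  show "(\<lambda>k. (b + real (Suc k) * m) powr p * (K * exp (- c * real k))) \<in> O(\<lambda>k. 1 / real k ^ 2)"
    using assms by real_asymp
qed

text \<open>Interpolation by cutting at a height \<open>K\<close>: below it the power \<alpha> is at
  most \<open>K powr (\<alpha> - 1)\<close> times the modulus, above it at most \<open>1 / K\<close>
  times the power \<alpha> + 1. For fixed \<open>K\<close> the first part tends to 0, and the second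
  is small uniformly in \<open>n\<close> once \<open>K\<close> is large.\<close>

lemma tendsto_nn_integral_powr:
  fixes h :: "nat \<Rightarrow> 'a \<Rightarrow> real"
  assumes [measurable]: "\<And>n. h n \<in> borel_measurable M"
    and "\<alpha> \<ge> 1"
    and lim: "(\<lambda>n. \<integral>\<^sup>+x. ennreal \<bar>h n x\<bar> \<partial>M) \<longlonglongrightarrow> 0"
    and bd: "\<And>n. (\<integral>\<^sup>+x. ennreal (\<bar>h n x\<bar> powr (\<alpha> + 1)) \<partial>M) \<le> ennreal C"
  shows "(\<lambda>n. \<integral>\<^sup>+x. ennreal (\<bar>h n x\<bar> powr \<alpha>) \<partial>M) \<longlonglongrightarrow> 0"
proof -
  have est: "(\<integral>\<^sup>+x. ennreal (\<bar>h n x\<bar> powr \<alpha>) \<partial>M)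
      \<le> ennreal (K powr (\<alpha> - 1)) * (\<integral>\<^sup>+x. ennreal \<bar>h n x\<bar> \<partial>M) + ennreal (1 / K) * ennreal C"
    if "K > 0" for K n
  proof -
    have pw: "\<bar>h n x\<bar> powr \<alpha> \<le> K powr (\<alpha> - 1) * \<bar>h n x\<bar> + 1 / K * \<bar>h n x\<bar> powr (\<alpha> + 1)" for x
    proof (cases "\<bar>h n x\<bar> \<le> K")
      case True
      have "\<bar>h n x\<bar> powr \<alpha> = \<bar>h n x\<bar> powr (\<alpha> - 1) * \<bar>h n x\<bar>"
        using powr_mult_base[of "\<bar>h n x\<bar>" "\<alpha> - 1"] by (simp add: mult.commute)
      also have "\<dots> \<le> K powr (\<alpha> - 1) * \<bar>h n x\<bar>"
        using True \<open>\<alpha> \<ge> 1\<close> by (intro mult_right_mono powr_mono2) auto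
      finally show ?thesis using \<open>K > 0\<close> by (smt (verit) divide_nonneg_pos mult_nonneg_nonneg powr_ge_zero)
    next
      case False
      have "K * \<bar>h n x\<bar> powr \<alpha> \<le> \<bar>h n x\<bar> * \<bar>h n x\<bar> powr \<alpha>"
        using False by (intro mult_right_mono) auto
      also have "\<dots> = \<bar>h n x\<bar> powr (\<alpha> + 1)"
        using powr_mult_base[of "\<bar>h n x\<bar>" \<alpha>] by (simp add: add.commute)
      finally have "\<bar>h n x\<bar> powr \<alpha> \<le> 1 / K * \<bar>h n x\<bar> powr (\<alpha> + 1)"
        using \<open>K > 0\<close> by (simp add: field_simps)
      then show ?thesis by (simp add: add_increasing)
    qed
    have "(\<integral>\<^sup>+x. ennreal (\<bar>h n x\<bar> powr \<alpha>) \<partial>M)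
        \<le> (\<integral>\<^sup>+x. ennreal (K powr (\<alpha> - 1)) * ennreal \<bar>h n x\<bar>
              + ennreal (1 / K) * ennreal (\<bar>h n x\<bar> powr (\<alpha> + 1)) \<partial>M)"
      using pw \<open>K > 0\<close> by (intro nn_integral_mono) (simp flip: ennreal_mult ennreal_plus)
    also have "\<dots> = ennreal (K powr (\<alpha> - 1)) * (\<integral>\<^sup>+x. ennreal \<bar>h n x\<bar> \<partial>M)
        + ennreal (1 / K) * (\<integral>\<^sup>+x. ennreal (\<bar>h n x\<bar> powr (\<alpha> + 1)) \<partial>M)"
      by (subst nn_integral_add) (simp_all add: nn_integral_cmult)
    also have "\<dots> \<le> ennreal (K powr (\<alpha> - 1)) * (\<integral>\<^sup>+x. ennreal \<bar>h n x\<bar> \<partial>M) + ennreal (1 / K) * ennreal C"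
      by (intro add_left_mono mult_left_mono bd) auto
    finally show ?thesis .
  qed
  have "\<forall>\<^sub>F n in sequentially. (\<integral>\<^sup>+x. ennreal (\<bar>h n x\<bar> powr \<alpha>) \<partial>M) < ennreal e" if "e > 0" for e
  proof -
    \<comment> \<open>Chosen so that \<open>C / K\<close> stays strictly below \<open>e\<close>; the
      summand 1 keeps \<open>K\<close> positive when \<open>C = 0\<close>.\<close>
    define K where "K = (\<bar>C\<bar> + 1) * 2 / e"
    have K: "K > 0" using that by (simp add: K_def)
    have KC: "ennreal (1 / K) * ennreal C < ennreal e"
    proof -
      have "1 / K * \<bar>C\<bar> < e" using that by (simp add: K_def field_simps add_nonneg_pos)
      then show ?thesis using K that
        by (smt (verit, best) divide_nonneg_nonneg ennreal_leI ennreal_lessI ennreal_mult'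
            le_less_trans mult_left_mono zero_le abs_ge_self)
    qed
    have "(\<lambda>n. ennreal (K powr (\<alpha> - 1)) * (\<integral>\<^sup>+x. ennreal \<bar>h n x\<bar> \<partial>M) + ennreal (1 / K) * ennreal C)
        \<longlonglongrightarrow> ennreal (K powr (\<alpha> - 1)) * 0 + ennreal (1 / K) * ennreal C"
      by (intro tendsto_intros ennreal_tendsto_cmult lim) auto
    then have "\<forall>\<^sub>F n in sequentially. ennreal (K powr (\<alpha> - 1)) * (\<integral>\<^sup>+x. ennreal \<bar>h n x\<bar> \<partial>M)
        + ennreal (1 / K) * ennreal C < ennreal e"
      using KC by (intro order_tendstoD(2)) auto
    then show ?thesis by eventually_elim (use est[OF K] in \<open>blast intro: le_less_trans\<close>)
  qed
  note * = this
  show ?thesis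
  proof (rule order_tendstoI)
    fix a :: ennreal assume "0 < a"
    then obtain e where "e > 0" "ennreal e < a"
      by (metis dense ennreal_cases ennreal_less_zero_iff less_top_ennreal order.strict_trans
          top.not_eq_extremum)
    then show "\<forall>\<^sub>F n in sequentially. (\<integral>\<^sup>+x. ennreal (\<bar>h n x\<bar> powr \<alpha>) \<partial>M) < a"
      using *[of e] by (auto elim: eventually_mono)
  qed simp
qed

text \<open>Fatou's lemma, in the form used to transfer uniform bounds to an almost everywhere
  limit.\<close>

lemma nn_integral_le_of_tendsto:
  fixes u :: "nat \<Rightarrow> 'a \<Rightarrow> ennreal"
  assumes [measurable]: "\<And>k. u k \<in> borel_measurable M"
    and lim: "AE x in M. (\<lambda>k. u k x) \<longlonglongrightarrow> v x"
    and le: "\<forall>\<^sub>F k in sequentially. (\<integral>\<^sup>+x. u k x \<partial>M) \<le> c"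
  shows "(\<integral>\<^sup>+x. v x \<partial>M) \<le> c"
proof -
  have "(\<integral>\<^sup>+x. v x \<partial>M) = (\<integral>\<^sup>+x. liminf (\<lambda>k. u k x) \<partial>M)"
    using lim by (intro nn_integral_cong_AE) (auto elim!: eventually_mono simp: lim_imp_Liminf)
  also have "\<dots> \<le> liminf (\<lambda>k. \<integral>\<^sup>+x. u k x \<partial>M)"
    by (rule nn_integral_liminf) measurable
  also have "\<dots> \<le> liminf (\<lambda>k. c)"
    using le by (rule Liminf_mono)
  finally show ?thesis by (simp add: Liminf_const)
qed

lemma in_Lp_iff_nn_integral:
  assumes "h \<in> borel_measurable M"
  shows "h \<in> Lp p M \<longleftrightarrow> (\<integral>\<^sup>+x. ennreal (\<bar>h x\<bar> powr p) \<partial>M) < \<infinity>"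
  using assms by (simp add: Lp_def integrable_iff_bounded)

lemma nn_integral_powr_diff_le:
  fixes u v :: "'a \<Rightarrow> real"
  assumes [measurable]: "u \<in> borel_measurable M" "v \<in> borel_measurable M"
    and "p \<ge> 0"
  shows "(\<integral>\<^sup>+x. ennreal (\<bar>u x - v x\<bar> powr p) \<partial>M)
    \<le> ennreal (2 powr p) * ((\<integral>\<^sup>+x. ennreal (\<bar>u x\<bar> powr p) \<partial>M) + (\<integral>\<^sup>+x. ennreal (\<bar>v x\<bar> powr p) \<partial>M))"
proof -
  have pw: "\<bar>u x - v x\<bar> powr p \<le> 2 powr p * (\<bar>u x\<bar> powr p + \<bar>v x\<bar> powr p)" for x
  proof -
    have "\<bar>u x - v x\<bar> powr p \<le> (2 * max \<bar>u x\<bar> \<bar>v x\<bar>) powr p"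
      using \<open>p \<ge> 0\<close> by (intro powr_mono2) auto
    also have "\<dots> = 2 powr p * max \<bar>u x\<bar> \<bar>v x\<bar> powr p" by (simp add: powr_mult)
    also have "\<dots> \<le> 2 powr p * (\<bar>u x\<bar> powr p + \<bar>v x\<bar> powr p)"
      by (intro mult_left_mono) (auto simp: max_def)
    finally show ?thesis .
  qed
  have "(\<integral>\<^sup>+x. ennreal (\<bar>u x - v x\<bar> powr p) \<partial>M)
      \<le> (\<integral>\<^sup>+x. ennreal (2 powr p) * (ennreal (\<bar>u x\<bar> powr p) + ennreal (\<bar>v x\<bar> powr p)) \<partial>M)"
    using pw by (intro nn_integral_mono) (simp flip: ennreal_mult ennreal_plus)
  also have "\<dots> = ennreal (2 powr p) * ((\<integral>\<^sup>+x. ennreal (\<bar>u x\<bar> powr p) \<partial>M) + (\<integral>\<^sup>+x. ennreal (\<bar>v x\<bar> powr p) \<partial>M))"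
    by (subst nn_integral_cmult, measurable, subst nn_integral_add) auto
  finally show ?thesis .
qed

text \<open>The moments of order \<open>p + 1\<close> of \<open>u n\<close> and \<open>g\<close>
  bound those of the differences uniformly, so interpolation between orders 1 and
  \<open>p + 1\<close> upgrades convergence in mean to order \<open>p\<close>.\<close>

lemma converges_in_LpI:
  fixes u :: "nat \<Rightarrow> 'a \<Rightarrow> real"
  assumes [measurable]: "\<And>n. u n \<in> borel_measurable M" "g \<in> borel_measurable M"
    and "p \<ge> 1"
    and lim: "(\<lambda>n. \<integral>\<^sup>+x. ennreal \<bar>u n x - g x\<bar> \<partial>M) \<longlonglongrightarrow> 0"
    and bd: "\<And>p. p \<ge> 1 \<Longrightarrow> \<exists>C. \<forall>n. (\<integral>\<^sup>+x. ennreal (\<bar>u n x\<bar> powr p) \<partial>M) \<le> ennreal C"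
    and bdg: "\<And>p. p \<ge> 1 \<Longrightarrow> \<exists>C. (\<integral>\<^sup>+x. ennreal (\<bar>g x\<bar> powr p) \<partial>M) \<le> ennreal C"
  shows "converges_in_Lp p M u g"
proof -
  from \<open>p \<ge> 1\<close> obtain C D where
    C: "\<And>n. (\<integral>\<^sup>+x. ennreal (\<bar>u n x\<bar> powr (p + 1)) \<partial>M) \<le> ennreal C" and
    D: "(\<integral>\<^sup>+x. ennreal (\<bar>g x\<bar> powr (p + 1)) \<partial>M) \<le> ennreal D"
    using bd[of "p + 1"] bdg[of "p + 1"] by auto
  have "(\<integral>\<^sup>+x. ennreal (\<bar>u n x - g x\<bar> powr (p + 1)) \<partial>M) \<le> ennreal (2 powr (p + 1) * (\<bar>C\<bar> + \<bar>D\<bar>))" for n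
  proof -
    have "(\<integral>\<^sup>+x. ennreal (\<bar>u n x - g x\<bar> powr (p + 1)) \<partial>M)
      \<le> ennreal (2 powr (p + 1)) * (ennreal \<bar>C\<bar> + ennreal \<bar>D\<bar>)"
      using \<open>p \<ge> 1\<close>
      by (intro order_trans[OF nn_integral_powr_diff_le] mult_left_mono add_mono
          order_trans[OF C] order_trans[OF D] ennreal_leI) auto
    then show ?thesis by (simp add: ennreal_mult)
  qed
  then have lim': "(\<lambda>n. \<integral>\<^sup>+x. ennreal (\<bar>u n x - g x\<bar> powr p) \<partial>M) \<longlonglongrightarrow> 0"
    using lim \<open>p \<ge> 1\<close> by (intro tendsto_nn_integral_powr) measurable
  have "(\<lambda>n. (\<integral>x. \<bar>u n x - g x\<bar> powr p \<partial>M)) \<longlonglongrightarrow> 0"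
    using tendsto_enn2real[where l = 0, unfolded ennreal_0, OF lim'] by (simp add: integral_eq_nn_integral)
  then have "(\<lambda>n. Lp_norm p M (\<lambda>x. u n x - g x)) \<longlonglongrightarrow> 0"
    unfolding Lp_norm_def using \<open>p \<ge> 1\<close>
    by (intro tendsto_zero_powrI[where b = "1 / p"]) auto
  moreover have "u n \<in> Lp p M" for n
    using bd[OF \<open>p \<ge> 1\<close>] by (auto simp: in_Lp_iff_nn_integral intro: le_less_trans)
  moreover have "g \<in> Lp p M"
    using bdg[OF \<open>p \<ge> 1\<close>] by (auto simp: in_Lp_iff_nn_integral intro: le_less_trans)
  ultimately show ?thesis by (simp add: converges_in_Lp_def)
qed

text \<open>The constant \<open>C\<close> is fixed before \<open>h\<close>, so one bound serves a
  whole sequence with common tails. It is finite because exponential decay of the tails beats the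
  polynomial growth of the weights.\<close>

lemma bounded_moments_if_exp_tails:
  fixes b m c K :: real
  assumes "finite_measure M" "m > 0" "c > 0" "K \<ge> 0" "p \<ge> 0"
  obtains C where "\<And>h. h \<in> borel_measurable M \<Longrightarrow>
      (\<And>k. emeasure M {x \<in> space M. \<bar>h x\<bar> > b + real k * m} \<le> ennreal (K * exp (- c * real k))) \<Longrightarrow>
      (\<integral>\<^sup>+x. ennreal (\<bar>h x\<bar> powr p) \<partial>M) \<le> ennreal C"
proof
  interpret finite_measure M by fact
  let ?t = "\<lambda>k. (b + real (Suc k) * m) powr p * (K * exp (- c * real k))"
  fix h assume h: "h \<in> borel_measurable M"
    and tail: "\<And>k. emeasure M {x \<in> space M. \<bar>h x\<bar> > b + real k * m} \<le> ennreal (K * exp (- c * real k))"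
  have "(\<integral>\<^sup>+x. ennreal (\<bar>h x\<bar> powr p) \<partial>M)
      \<le> ennreal (b powr p) * emeasure M (space M) + (\<Sum>k. ennreal (?t k))"
    using assms by (intro nn_integral_powr_le_suminf_tails h tail) auto
  also have "(\<Sum>k. ennreal (?t k)) = ennreal (\<Sum>k. ?t k)"
    using assms summable_powr_times_exp by (intro suminf_ennreal2) auto
  also have "ennreal (b powr p) * emeasure M (space M) + ennreal (\<Sum>k. ?t k)
      = ennreal (b powr p * measure M (space M) + (\<Sum>k. ?t k))"
    using assms summable_powr_times_exp[of m c b p K]
    by (subst ennreal_plus) (auto simp: emeasure_eq_measure ennreal_mult intro!: suminf_nonneg)
  finally show "(\<integral>\<^sup>+x. ennreal (\<bar>h x\<bar> powr p) \<partial>M)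
      \<le> ennreal (b powr p * measure M (space M) + (\<Sum>k. ?t k))" .
qed

text \<open>On \<open>B i\<close> the difference splits as
  \<open>(u - a i) + (b i - v) + (a i - b i)\<close>; summing over all sets of the cover, overlaps
  included, only enlarges the bound. The crude factor \<open>card I\<close> is harmless because
  \<eta> can be chosen after the cover.\<close>

lemma nn_integral_power2_diff_le_cover:
  fixes u v :: "'a \<Rightarrow> real"
  assumes [measurable]: "u \<in> borel_measurable M" "v \<in> borel_measurable M" "\<And>i. i \<in> I \<Longrightarrow> B i \<in> sets M"
    and fin: "finite I" and cov: "space M \<subseteq> (\<Union>i\<in>I. B i)"
    and ab: "\<And>i. i \<in> I \<Longrightarrow> \<bar>a i - b i\<bar> \<le> \<eta>"
  shows "(\<integral>\<^sup>+x. ennreal ((u x - v x)\<^sup>2) \<partial>M) \<le>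
    3 * ((\<Sum>i\<in>I. \<integral>\<^sup>+x\<in>B i. ennreal ((u x - a i)\<^sup>2) \<partial>M) + (\<Sum>i\<in>I. \<integral>\<^sup>+x\<in>B i. ennreal ((v x - b i)\<^sup>2) \<partial>M)
        + of_nat (card I) * (ennreal (\<eta>\<^sup>2) * emeasure M (space M)))"
proof -
  let ?F = "\<lambda>i x. ennreal ((u x - a i)\<^sup>2) * indicator (B i) x + ennreal ((v x - b i)\<^sup>2) * indicator (B i) x
      + ennreal (\<eta>\<^sup>2) * indicator (B i) x"
  have "(\<integral>\<^sup>+x. ennreal ((u x - v x)\<^sup>2) \<partial>M) \<le> (\<integral>\<^sup>+x. 3 * (\<Sum>i\<in>I. ?F i x) \<partial>M)"
  proof (rule nn_integral_mono)
    fix x assume "x \<in> space M"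
    then obtain i where i: "i \<in> I" "x \<in> B i" using cov by auto
    have sq: "(p + q + r)\<^sup>2 \<le> 3 * (p\<^sup>2 + q\<^sup>2 + r\<^sup>2)" for p q r :: real
    proof -
      have "0 \<le> (p - q)\<^sup>2 + (q - r)\<^sup>2 + (p - r)\<^sup>2" by simp
      then show ?thesis by (simp add: power2_eq_square algebra_simps)
    qed
    have "(u x - v x)\<^sup>2 = ((u x - a i) + (b i - v x) + (a i - b i))\<^sup>2" by simp
    also have "\<dots> \<le> 3 * ((u x - a i)\<^sup>2 + (b i - v x)\<^sup>2 + (a i - b i)\<^sup>2)" by (rule sq)
    also have "\<dots> \<le> 3 * ((u x - a i)\<^sup>2 + (v x - b i)\<^sup>2 + \<eta>\<^sup>2)"
      using ab[OF i(1)] abs_le_square_iff[of "a i - b i" \<eta>] by (simp add: power2_commute)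
    finally have "ennreal ((u x - v x)\<^sup>2) \<le> ennreal (3 * ((u x - a i)\<^sup>2 + (v x - b i)\<^sup>2 + \<eta>\<^sup>2))"
      by (rule ennreal_leI)
    also have "\<dots> = 3 * (ennreal ((u x - a i)\<^sup>2) + ennreal ((v x - b i)\<^sup>2) + ennreal (\<eta>\<^sup>2))"
      by (simp add: ennreal_mult' ennreal_plus)
    also have "\<dots> = 3 * ?F i x" using i by simp
    also have "\<dots> \<le> 3 * (\<Sum>i\<in>I. ?F i x)"
      using i fin by (intro mult_left_mono member_le_sum) auto
    finally show "ennreal ((u x - v x)\<^sup>2) \<le> 3 * (\<Sum>i\<in>I. ?F i x)" .
  qed
  also have "\<dots> = 3 * ((\<Sum>i\<in>I. \<integral>\<^sup>+x\<in>B i. ennreal ((u x - a i)\<^sup>2) \<partial>M) + (\<Sum>i\<in>I. \<integral>\<^sup>+x\<in>B i. ennreal ((v x - b i)\<^sup>2) \<partial>M)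
        + (\<Sum>i\<in>I. ennreal (\<eta>\<^sup>2) * emeasure M (B i)))"
    by (simp add: nn_integral_cmult nn_integral_sum nn_integral_add sum.distrib nn_integral_cmult_indicator)
  also have "(\<Sum>i\<in>I. ennreal (\<eta>\<^sup>2) * emeasure M (B i)) \<le> (\<Sum>i\<in>I. ennreal (\<eta>\<^sup>2) * emeasure M (space M))"
    by (intro sum_mono mult_left_mono emeasure_space) auto
  finally show ?thesis by (simp add: add_left_mono mult_left_mono)
qed

text \<open>Integrates the pointwise bound of \<open>\<bar>y\<bar>\<close> by
  \<open>\<eta> + y\<^sup>2 / \<eta>\<close>; with \<eta> free this replaces the Cauchy-Schwarz
  inequality.\<close>

lemma (in finite_measure) nn_integral_abs_le_power2:
  fixes h :: "'a \<Rightarrow> real"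
  assumes [measurable]: "h \<in> borel_measurable M"
    and "\<eta> > 0"
  shows "(\<integral>\<^sup>+x. ennreal \<bar>h x\<bar> \<partial>M) \<le> ennreal (\<eta> * measure M (space M)) + ennreal (1 / \<eta>) * (\<integral>\<^sup>+x. ennreal ((h x)\<^sup>2) \<partial>M)"
proof -
  have pw: "\<bar>y\<bar> \<le> \<eta> + 1 / \<eta> * y\<^sup>2" for y :: real
  proof (cases "\<bar>y\<bar> \<le> \<eta>")
    case True
    then show ?thesis using \<open>\<eta> > 0\<close> by (simp add: add_increasing2)
  next
    case False
    then have "\<eta> * \<bar>y\<bar> \<le> \<bar>y\<bar> * \<bar>y\<bar>" by (intro mult_right_mono) auto
    then have "\<bar>y\<bar> \<le> 1 / \<eta> * y\<^sup>2" using \<open>\<eta> > 0\<close> by (simp add: field_simps power2_eq_square)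
    then show ?thesis using \<open>\<eta> > 0\<close> by simp
  qed
  have "(\<integral>\<^sup>+x. ennreal \<bar>h x\<bar> \<partial>M) \<le> (\<integral>\<^sup>+x. ennreal \<eta> + ennreal (1 / \<eta>) * ennreal ((h x)\<^sup>2) \<partial>M)"
    using pw \<open>\<eta> > 0\<close> by (intro nn_integral_mono) (simp flip: ennreal_mult ennreal_plus)
  also have "\<dots> = ennreal \<eta> * emeasure M (space M) + ennreal (1 / \<eta>) * (\<integral>\<^sup>+x. ennreal ((h x)\<^sup>2) \<partial>M)"
    by (simp add: nn_integral_add nn_integral_cmult)
  also have "ennreal \<eta> * emeasure M (space M) = ennreal (\<eta> * measure M (space M))"
    using \<open>\<eta> > 0\<close> by (simp add: emeasure_eq_measure ennreal_mult)
  finally show ?thesis .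
qed

text \<open>The compactness argument freed from balls and energies. At scale \<open>k\<close> a
  finite cover with local constants approximates every \<open>f n\<close> in mean square up to an
  exponentially small error, while the constants grow at most linearly in \<open>k\<close>. Decay
  against growth gives the moments; the finitely many constants at each scale give the Cauchy
  property.\<close>

lemma convergent_subsequence_of_approximate_averages:
  fixes f :: "nat \<Rightarrow> 'a \<Rightarrow> real" and B :: "nat \<Rightarrow> 'i \<Rightarrow> 'a set" and a :: "nat \<Rightarrow> nat \<Rightarrow> 'i \<Rightarrow> real"
  assumes "finite_measure M"
    and f[measurable]: "\<And>n. f n \<in> borel_measurable M"
    and B[measurable]: "\<And>k i. i \<in> I k \<Longrightarrow> B k i \<in> sets M"
    and fin: "\<And>k. finite (I k)" and cov: "\<And>k. space M \<subseteq> (\<Union>i\<in>I k. B k i)"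
    and est: "\<And>n k. (\<Sum>i\<in>I k. \<integral>\<^sup>+x\<in>B k i. ennreal ((f n x - a n k i)\<^sup>2) \<partial>M) \<le> ennreal (K * exp (- c * real k))"
    and a: "\<And>n k i. i \<in> I k \<Longrightarrow> \<bar>a n k i\<bar> \<le> b + real k * m"
    and "m > 0" "c > 0" "K \<ge> 0" "b \<ge> 0"
  shows "\<exists>s g. strict_mono s \<and> (\<forall>\<alpha>\<ge>1. converges_in_Lp \<alpha> M (\<lambda>n. f (s n)) g)"
proof -
  interpret finite_measure M by fact
  define V where "V = measure M (space M)"
  have "V \<ge> 0" and V: "emeasure M (space M) = ennreal V"
    by (auto simp: V_def emeasure_eq_measure)
  \<comment> \<open>The level rises from \<open>b\<close> to \<open>b + 1\<close> because the
    Chebyshev bound needs a gap of 1 above the local constants.\<close>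
  have tail: "emeasure M {x \<in> space M. \<bar>f n x\<bar> > (b + 1) + real k * m} \<le> ennreal (K * exp (- c * real k))" for n k
    using emeasure_tail_le[OF f B fin cov a est, of k] by (simp add: algebra_simps)
  have moments: "\<exists>C. \<forall>n. (\<integral>\<^sup>+x. ennreal (\<bar>f n x\<bar> powr p) \<partial>M) \<le> ennreal C" if "p \<ge> 1" for p
  proof -
    obtain C where C: "\<And>h. h \<in> borel_measurable M \<Longrightarrow>
      (\<And>k. emeasure M {x \<in> space M. \<bar>h x\<bar> > (b + 1) + real k * m} \<le> ennreal (K * exp (- c * real k))) \<Longrightarrow>
      (\<integral>\<^sup>+x. ennreal (\<bar>h x\<bar> powr p) \<partial>M) \<le> ennreal C"
      by (rule bounded_moments_if_exp_tails[OF assms(1) \<open>m > 0\<close> \<open>c > 0\<close> \<open>K \<ge> 0\<close>, of p "b + 1"])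
        (use \<open>p \<ge> 1\<close> in auto)
    show ?thesis using C[OF f tail] by blast
  qed

  \<comment> \<open>Diagonal subsequence of the local constants\<close>
  have "countable (Sigma UNIV I)"
    using fin by (auto intro: countable_finite)
  \<comment> \<open>The diagonal extraction asks for one bound valid for all indices, whereas the
    constants grow with the scale; hence the division, undone afterwards. The summand 1 keeps the
    divisor positive even for \<open>b = 0\<close> and \<open>k = 0\<close>.\<close>
  moreover have "norm (a n (fst ki) (snd ki) / (b + 1 + real (fst ki) * m)) \<le> 1" if "ki \<in> Sigma UNIV I" for n ki
  proof -
    have "\<bar>a n (fst ki) (snd ki)\<bar> \<le> b + real (fst ki) * m" using a[of "snd ki" "fst ki" n] that by auto
    moreover have "0 \<le> b + real (fst ki) * m" using \<open>m > 0\<close> \<open>b \<ge> 0\<close> by simp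
    ultimately show ?thesis by (simp add: divide_le_eq_1)
  qed
  ultimately obtain s where s: "strict_mono s" and
    conv: "\<And>ki. ki \<in> Sigma UNIV I \<Longrightarrow>
      \<exists>l. (\<lambda>n. a (s n) (fst ki) (snd ki) / (b + 1 + real (fst ki) * m)) \<longlonglongrightarrow> l"
    using function_convergent_subsequence[of "Sigma UNIV I"
        "\<lambda>n ki. a n (fst ki) (snd ki) / (b + 1 + real (fst ki) * m)" 1] by metis
  have Cauchy_a: "Cauchy (\<lambda>n. a (s n) k i)" if i: "i \<in> I k" for k i
  proof -
    obtain l where "(\<lambda>n. a (s n) k i / (b + 1 + real k * m)) \<longlonglongrightarrow> l"
      using conv[of "(k, i)"] i by auto
    then have "(\<lambda>n. a (s n) k i / (b + 1 + real k * m) * (b + 1 + real k * m)) \<longlonglongrightarrow> l * (b + 1 + real k * m)"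
      by (rule tendsto_mult_right)
    moreover have "b + 1 + real k * m \<noteq> 0"
      using \<open>m > 0\<close> \<open>b \<ge> 0\<close> by (smt (verit) mult_nonneg_nonneg of_nat_0_le_iff)
    ultimately show ?thesis by (auto intro: LIMSEQ_imp_Cauchy)
  qed
  have Cauchy_a': "\<exists>N. \<forall>i\<in>I k. \<forall>n\<ge>N. \<forall>n'\<ge>N. \<bar>a (s n) k i - a (s n') k i\<bar> \<le> \<eta>" if "\<eta> > 0" for k \<eta>
  proof -
    have "\<forall>i\<in>I k. \<exists>N. \<forall>n\<ge>N. \<forall>n'\<ge>N. \<bar>a (s n) k i - a (s n') k i\<bar> < \<eta>"
      using Cauchy_a that by (simp add: Cauchy_def dist_real_def)
    then obtain N where N: "\<forall>i\<in>I k. \<forall>n\<ge>N i. \<forall>n'\<ge>N i. \<bar>a (s n) k i - a (s n') k i\<bar> < \<eta>"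
      by metis
    show ?thesis
    proof (intro exI[of _ "Max (N ` I k)"] ballI allI impI)
      fix i n n' assume *: "i \<in> I k" "n \<ge> Max (N ` I k)" "n' \<ge> Max (N ` I k)"
      have "N i \<le> Max (N ` I k)" using fin *(1) by auto
      then show "\<bar>a (s n) k i - a (s n') k i\<bar> \<le> \<eta>"
        using N * by (meson le_trans less_imp_le)
    qed
  qed

  \<comment> \<open>Cauchy property in mean square and in mean\<close>
  have L2: "\<exists>N. \<forall>n\<ge>N. \<forall>n'\<ge>N. (\<integral>\<^sup>+x. ennreal ((f (s n) x - f (s n') x)\<^sup>2) \<partial>M) \<le> ennreal \<delta>" if "\<delta> > 0" for \<delta>
  proof -
    \<comment> \<open>The budget is \<open>3 * (\<delta> / 12 + \<delta> / 12 + \<delta> / 6) =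
      \<delta>\<close>: two approximation errors at scale \<open>k\<close>, and one contribution
      from the differing constants. The scale comes first, since \<open>card (I k)\<close> enters
      \<open>D\<close> and thereby \<eta>.\<close>
    have "(\<lambda>k. K * exp (- c * real k)) \<longlonglongrightarrow> 0"
      using \<open>c > 0\<close> by real_asymp
    then have "\<forall>\<^sub>F k in sequentially. K * exp (- c * real k) < \<delta> / 12"
      using that by (intro order_tendstoD) auto
    then obtain k where k: "K * exp (- c * real k) < \<delta> / 12"
      by (auto dest: eventually_happens)
    define D where "D = 6 * (real (card (I k)) + 1) * (V + 1)"
    have "D > 0" unfolding D_def using \<open>V \<ge> 0\<close> by (intro mult_pos_pos) auto
    define \<eta> where "\<eta> = sqrt (\<delta> / D)"
    have "\<eta> > 0" and \<eta>2: "\<eta>\<^sup>2 = \<delta> / D"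
      using \<open>D > 0\<close> that by (auto simp: \<eta>_def)
    have cardV: "real (card (I k)) * (\<eta>\<^sup>2 * V) \<le> \<delta> / 6"
    proof -
      have "6 * (real (card (I k)) * V) \<le> D"
        unfolding D_def using \<open>V \<ge> 0\<close> by (simp add: algebra_simps)
      then have "6 * (real (card (I k)) * V) * \<delta> \<le> D * \<delta>"
        using that by (intro mult_right_mono) auto
      then show ?thesis unfolding \<eta>2 using \<open>D > 0\<close> by (simp add: field_simps)
    qed
    from Cauchy_a'[OF \<open>\<eta> > 0\<close>, of k] obtain N where
      N: "\<And>i n n'. i \<in> I k \<Longrightarrow> n \<ge> N \<Longrightarrow> n' \<ge> N \<Longrightarrow> \<bar>a (s n) k i - a (s n') k i\<bar> \<le> \<eta>"
      by blast
    have "(\<integral>\<^sup>+x. ennreal ((f (s n) x - f (s n') x)\<^sup>2) \<partial>M) \<le> ennreal \<delta>" if "n \<ge> N" "n' \<ge> N" for n n'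
    proof -
      have "(\<integral>\<^sup>+x. ennreal ((f (s n) x - f (s n') x)\<^sup>2) \<partial>M)
        \<le> 3 * ((\<Sum>i\<in>I k. \<integral>\<^sup>+x\<in>B k i. ennreal ((f (s n) x - a (s n) k i)\<^sup>2) \<partial>M)
            + (\<Sum>i\<in>I k. \<integral>\<^sup>+x\<in>B k i. ennreal ((f (s n') x - a (s n') k i)\<^sup>2) \<partial>M)
            + of_nat (card (I k)) * (ennreal (\<eta>\<^sup>2) * emeasure M (space M)))"
        using that by (intro nn_integral_power2_diff_le_cover f B fin cov N) auto
      also have "\<dots> \<le> 3 * (ennreal (\<delta> / 12) + ennreal (\<delta> / 12)
            + of_nat (card (I k)) * (ennreal (\<eta>\<^sup>2) * ennreal V))"
        unfolding V using k by (intro mult_left_mono add_mono order_trans[OF est] ennreal_leI) auto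
      also have "of_nat (card (I k)) * (ennreal (\<eta>\<^sup>2) * ennreal V) = ennreal (real (card (I k)) * (\<eta>\<^sup>2 * V))"
        using \<open>V \<ge> 0\<close> by (simp add: ennreal_mult ennreal_of_nat_eq_real_of_nat)
      also have "3 * (ennreal (\<delta> / 12) + ennreal (\<delta> / 12) + ennreal (real (card (I k)) * (\<eta>\<^sup>2 * V)))
          = ennreal (3 * (\<delta> / 12 + \<delta> / 12 + real (card (I k)) * (\<eta>\<^sup>2 * V)))"
        using \<open>\<delta> > 0\<close> \<open>V \<ge> 0\<close> ennreal_mult'[of 3 "\<delta> / 12 + \<delta> / 12 + real (card (I k)) * (\<eta>\<^sup>2 * V)"]
        by (simp flip: ennreal_plus)
      also have "\<dots> \<le> ennreal \<delta>"
        using cardV by (intro ennreal_leI) simp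
      finally show ?thesis .
    qed
    then show ?thesis by blast
  qed
  have L1: "\<exists>N. \<forall>n\<ge>N. \<forall>n'\<ge>N. (\<integral>\<^sup>+x. ennreal \<bar>f (s n) x - f (s n') x\<bar> \<partial>M) \<le> ennreal e" if "e > 0" for e
  proof -
    \<comment> \<open>With this \<eta> and mean-square distance at most
      \<open>\<eta> * e / 2\<close>, each of the two terms of the estimate is at most
      \<open>e / 2\<close>.\<close>
    define \<eta> where "\<eta> = e / (2 * (V + 1))"
    have "\<eta> > 0" and \<eta>V: "\<eta> * V \<le> e / 2"
      using that \<open>V \<ge> 0\<close> by (auto simp: \<eta>_def field_simps)
    obtain N where N: "\<And>n n'. n \<ge> N \<Longrightarrow> n' \<ge> N \<Longrightarrow>
        (\<integral>\<^sup>+x. ennreal ((f (s n) x - f (s n') x)\<^sup>2) \<partial>M) \<le> ennreal (\<eta> * e / 2)"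
      using L2[of "\<eta> * e / 2"] \<open>\<eta> > 0\<close> \<open>e > 0\<close> by auto
    have "(\<integral>\<^sup>+x. ennreal \<bar>f (s n) x - f (s n') x\<bar> \<partial>M) \<le> ennreal e" if "n \<ge> N" "n' \<ge> N" for n n'
    proof -
      have "(\<integral>\<^sup>+x. ennreal \<bar>f (s n) x - f (s n') x\<bar> \<partial>M)
          \<le> ennreal (\<eta> * V) + ennreal (1 / \<eta>) * (\<integral>\<^sup>+x. ennreal ((f (s n) x - f (s n') x)\<^sup>2) \<partial>M)"
        unfolding V_def using \<open>\<eta> > 0\<close> by (intro nn_integral_abs_le_power2) auto
      also have "\<dots> \<le> ennreal (e / 2) + ennreal (1 / \<eta>) * ennreal (\<eta> * e / 2)"
        using \<eta>V that by (intro add_mono mult_left_mono N ennreal_leI) auto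
      also have "\<dots> = ennreal (e / 2) + ennreal (e / 2)"
        using \<open>\<eta> > 0\<close> by (simp flip: ennreal_mult')
      also have "\<dots> = ennreal e"
        using \<open>e > 0\<close> by (simp flip: ennreal_plus)
      finally show ?thesis .
    qed
    then show ?thesis by blast
  qed

  \<comment> \<open>The limit function\<close>
  have int: "integrable M (f n)" for n
    using moments[of 1] by (auto simp: integrable_iff_bounded intro: le_less_trans)
  \<comment> \<open>The further subsequence \<open>r\<close> serves to define \<open>g\<close>
    pointwise almost everywhere and to apply Fatou; the convergence proved below is along all of
    \<open>s\<close>.\<close>
  obtain r where r: "strict_mono r" and Cauchy: "AE x in M. Cauchy (\<lambda>i. f (s (r i)) x)"
  proof (rule cauchy_L1_AE_cauchy_subseq[of M "\<lambda>n. f (s n)"])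
    fix e :: real assume "e > 0"
    then obtain N where N: "\<And>n n'. n \<ge> N \<Longrightarrow> n' \<ge> N \<Longrightarrow>
        (\<integral>\<^sup>+x. ennreal \<bar>f (s n) x - f (s n') x\<bar> \<partial>M) \<le> ennreal (e / 2)"
      using L1[of "e / 2"] by auto
    have "(\<integral>x. norm (f (s n) x - f (s n') x) \<partial>M) < e" if "n \<ge> N" "n' \<ge> N" for n n'
    proof -
      have "(\<integral>x. norm (f (s n) x - f (s n') x) \<partial>M) = enn2real (\<integral>\<^sup>+x. ennreal \<bar>f (s n) x - f (s n') x\<bar> \<partial>M)"
        by (simp add: integral_eq_nn_integral)
      also have "\<dots> \<le> e / 2" using \<open>e > 0\<close> N[OF that] by (intro enn2real_leI) auto
      finally show ?thesis using \<open>e > 0\<close> by simp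
    qed
    then show "\<exists>N. \<forall>i\<ge>N. \<forall>j\<ge>N. (\<integral>x. norm (f (s i) x - f (s j) x) \<partial>M) < e" by blast
  qed (use int in auto)
  define g where "g x = lim (\<lambda>i. f (s (r i)) x)" for x
  have g[measurable]: "g \<in> borel_measurable M"
    unfolding g_def by measurable
  have AE_g: "AE x in M. (\<lambda>i. f (s (r i)) x) \<longlonglongrightarrow> g x"
    using Cauchy by eventually_elim (simp add: g_def Cauchy_convergent_iff convergent_LIMSEQ_iff)

  have lim: "(\<lambda>n. \<integral>\<^sup>+x. ennreal \<bar>f (s n) x - g x\<bar> \<partial>M) \<longlonglongrightarrow> 0"
  proof (rule order_tendstoI)
    fix y :: ennreal assume "0 < y"
    then obtain e where "e > 0" "ennreal e < y"
      by (metis dense ennreal_cases ennreal_less_zero_iff less_top_ennreal order.strict_trans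
          top.not_eq_extremum)
    obtain N where N: "\<And>n n'. n \<ge> N \<Longrightarrow> n' \<ge> N \<Longrightarrow>
        (\<integral>\<^sup>+x. ennreal \<bar>f (s n) x - f (s n') x\<bar> \<partial>M) \<le> ennreal e"
      using L1[of e] \<open>e > 0\<close> by auto
    \<comment> \<open>Fatou in \<open>k\<close> with \<open>n\<close> fixed; since
      \<open>k \<le> r k\<close>, the Cauchy bound applies to the pair \<open>n\<close>,
      \<open>r k\<close> as soon as \<open>k \<ge> N\<close>.\<close>
    have "(\<integral>\<^sup>+x. ennreal \<bar>f (s n) x - g x\<bar> \<partial>M) \<le> ennreal e" if "n \<ge> N" for n
    proof (rule nn_integral_le_of_tendsto[where u = "\<lambda>k x. ennreal \<bar>f (s n) x - f (s (r k)) x\<bar>"])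
      show "AE x in M. (\<lambda>k. ennreal \<bar>f (s n) x - f (s (r k)) x\<bar>) \<longlonglongrightarrow> ennreal \<bar>f (s n) x - g x\<bar>"
        using AE_g by eventually_elim (intro tendsto_intros)
      show "\<forall>\<^sub>F k in sequentially. (\<integral>\<^sup>+x. ennreal \<bar>f (s n) x - f (s (r k)) x\<bar> \<partial>M) \<le> ennreal e"
        using eventually_ge_at_top[of N]
      proof eventually_elim
        case (elim k)
        then show ?case using seq_suble[OF r, of k] that by (intro N) auto
      qed
    qed measurable
    with \<open>ennreal e < y\<close> show "\<forall>\<^sub>F n in sequentially. (\<integral>\<^sup>+x. ennreal \<bar>f (s n) x - g x\<bar> \<partial>M) < y"
      by (auto simp: eventually_sequentially intro: le_less_trans)
  qed simp
  have moments_g: "\<exists>C. (\<integral>\<^sup>+x. ennreal (\<bar>g x\<bar> powr p) \<partial>M) \<le> ennreal C" if p: "p \<ge> 1" for p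
  proof -
    obtain C where C: "\<And>n. (\<integral>\<^sup>+x. ennreal (\<bar>f n x\<bar> powr p) \<partial>M) \<le> ennreal C"
      using moments[OF p] by blast
    have "(\<integral>\<^sup>+x. ennreal (\<bar>g x\<bar> powr p) \<partial>M) \<le> ennreal C"
    proof (rule nn_integral_le_of_tendsto[where u = "\<lambda>k x. ennreal (\<bar>f (s (r k)) x\<bar> powr p)"])
      show "AE x in M. (\<lambda>k. ennreal (\<bar>f (s (r k)) x\<bar> powr p)) \<longlonglongrightarrow> ennreal (\<bar>g x\<bar> powr p)"
        using AE_g by eventually_elim (use p in \<open>auto intro!: tendsto_intros\<close>)
    qed (use C in auto)
    then show ?thesis by blast
  qed
  have "converges_in_Lp \<alpha> M (\<lambda>n. f (s n)) g" if "\<alpha> \<ge> 1" for \<alpha>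
    using that moments by (intro converges_in_LpI lim moments_g f g) blast+
  with s show ?thesis by blast
qed

section \<open>Coverings with bounded overlap and Korevaar--Schoen energies\<close>

text \<open>Two points in one ball of radius \<open>R / 2\<close> are closer than \<open>R\<close>,
  so a finite cover by such balls bounds the size of every separated set. One of greatest
  cardinality exists, and a point missed by its balls could be added to it.\<close>

lemma compact_maximal_separated_set:
  fixes R :: real
  assumes "compact (UNIV :: 'a::metric_space set)" "R > 0"
  obtains S :: "'a::metric_space set" where "finite S" "\<And>x y. x \<in> S \<Longrightarrow> y \<in> S \<Longrightarrow> x \<noteq> y \<Longrightarrow> dist x y \<ge> R"
    "(\<Union>x\<in>S. ball x R) = UNIV"
proof -
  obtain T :: "'a set" where T: "finite T" "UNIV \<subseteq> (\<Union>t\<in>T. ball t (R / 2))"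
  proof (rule compactE_image[OF assms(1), of UNIV "\<lambda>t. ball t (R / 2)"])
    show "UNIV \<subseteq> (\<Union>t::'a\<in>UNIV. ball t (R / 2))"
      using \<open>R > 0\<close> by (auto intro: UN_I centre_in_ball[THEN iffD2])
  qed auto
  then have "\<forall>x. \<exists>t. t \<in> T \<and> dist t x < R / 2" by (auto simp: set_eq_iff subset_iff)
  then obtain t where t: "\<And>x. t x \<in> T \<and> dist (t x) x < R / 2" by metis
  define P where "P S \<longleftrightarrow> finite S \<and> (\<forall>x\<in>S. \<forall>y\<in>S. x \<noteq> y \<longrightarrow> dist x y \<ge> R)" for S :: "'a set"
  have card: "card S \<le> card T" if "P S" for S
  proof (rule card_inj_on_le)
    show "inj_on t S"
    proof (rule inj_onI, rule ccontr)
      fix x y assume *: "x \<in> S" "y \<in> S" "t x = t y" "x \<noteq> y"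
      have "dist x y \<le> dist (t x) x + dist (t x) y" by (rule dist_triangle3)
      also have "\<dots> < R" using t[of x] t[of y] * by simp
      finally show False using that * by (force simp: P_def)
    qed
  qed (use t T in auto)
  have "P {}" by (simp add: P_def)
  moreover have "\<forall>S. P S \<longrightarrow> card S < Suc (card T)" using card by (simp add: less_Suc_eq_le)
  ultimately have "\<exists>S. P S \<and> (\<forall>S'. P S' \<longrightarrow> card S' \<le> card S)"
    by (rule Lattices_Big.ex_has_greatest_nat)
  then obtain S where S: "P S" and max: "\<And>S'. P S' \<Longrightarrow> card S' \<le> card S"
    by blast
  have "y \<in> (\<Union>x\<in>S. ball x R)" for y
  proof (rule ccontr)
    assume y: "y \<notin> (\<Union>x\<in>S. ball x R)"
    then have "y \<notin> S" using \<open>R > 0\<close> by auto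
    moreover have "P (insert y S)"
      using S y by (auto simp: P_def not_less dist_commute)
    ultimately show False using max[of "insert y S"] S by (simp add: P_def)
  qed
  then show thesis using S by (intro that[of S]) (auto simp: P_def)
qed

text \<open>A packing argument: around the centres whose dilated balls contain \<open>y\<close>, the
  balls of radius \<open>R / 2\<close> are disjoint, lie in the ball about \<open>y\<close> of
  radius \<open>(L + 1) * R\<close>, and each carries at least the fraction \<open>1 / N\<close> of
  its measure. The ratio of \<open>(2 * L + 1) * R\<close> to \<open>R / 2\<close> gives
  \<open>4 * L + 2\<close>, so the bound does not depend on \<open>R\<close>.\<close>

lemma separated_overlap_le:
  fixes M :: "'a::metric_space measure" and C Q L R :: real and y :: 'a
  assumes "finite_measure M" "sets M = sets borel"
    and pos: "\<And>x r. r > 0 \<Longrightarrow> measure M (ball x r) > 0"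
    and growth: "\<And>x r R. 0 < r \<Longrightarrow> r \<le> R \<Longrightarrow> measure M (ball x R) \<le> C * (R / r) powr Q * measure M (ball x r)"
    and "finite S" and sep: "\<And>x y. x \<in> S \<Longrightarrow> y \<in> S \<Longrightarrow> x \<noteq> y \<Longrightarrow> dist x y \<ge> R"
    and "R > 0" "L \<ge> 1"
  shows "real (card {x \<in> S. y \<in> ball x (L * R)}) \<le> C * (4 * L + 2) powr Q"
proof -
  interpret finite_measure M by fact
  have sp: "space M = UNIV" using sets_eq_imp_space_eq[OF assms(2)] by simp
  have [measurable]: "ball x r \<in> sets M" for x r by (simp add: assms(2))
  define T where "T = {x \<in> S. y \<in> ball x (L * R)}"
  define N where "N = C * (4 * L + 2) powr Q"
  let ?Y = "measure M (ball y ((L + 1) * R))"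
  have "finite T" using \<open>finite S\<close> by (simp add: T_def)
  have Y: "?Y > 0" using \<open>R > 0\<close> \<open>L \<ge> 1\<close> by (intro pos) simp
  have each: "?Y \<le> N * measure M (ball x (R / 2))" if "x \<in> T" for x
  proof -
    have "dist x y < L * R" using that by (simp add: T_def)
    then have "ball y ((L + 1) * R) \<subseteq> ball x ((2 * L + 1) * R)"
    proof (intro subsetI, unfold mem_ball)
      fix z assume "dist y z < (L + 1) * R"
      then show "dist x z < (2 * L + 1) * R"
        using \<open>dist x y < L * R\<close> dist_triangle[of x z y] by (simp add: algebra_simps)
    qed
    then have "?Y \<le> measure M (ball x ((2 * L + 1) * R))"
      by (intro finite_measure_mono) auto
    also have "\<dots> \<le> C * ((2 * L + 1) * R / (R / 2)) powr Q * measure M (ball x (R / 2))"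
      using \<open>R > 0\<close> \<open>L \<ge> 1\<close> by (intro growth) (auto simp: field_simps)
    also have "(2 * L + 1) * R / (R / 2) = 4 * L + 2"
      using \<open>R > 0\<close> by (simp add: field_simps)
    finally show ?thesis by (simp add: N_def)
  qed
  have "disjoint_family_on (\<lambda>x. ball x (R / 2)) T"
  proof (unfold disjoint_family_on_def, intro ballI impI equals0I)
    fix x x' z assume "x \<in> T" "x' \<in> T" "x \<noteq> x'" "z \<in> ball x (R / 2) \<inter> ball x' (R / 2)"
    then have "dist x z < R / 2" "dist x' z < R / 2" "dist x x' \<ge> R"
      using sep by (auto simp: T_def)
    then show False using dist_triangle2[of x x' z] by linarith
  qed
  then have sum: "(\<Sum>x\<in>T. measure M (ball x (R / 2))) = measure M (\<Union>x\<in>T. ball x (R / 2))"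
    using \<open>finite T\<close> by (intro finite_measure_finite_Union[symmetric]) auto
  also have "\<dots> \<le> ?Y"
  proof (intro finite_measure_mono subsetI)
    fix z assume "z \<in> (\<Union>x\<in>T. ball x (R / 2))"
    then obtain x where "dist x y < L * R" "dist x z < R / 2" by (auto simp: T_def)
    then have "dist y z < L * R + R / 2" using dist_triangle3[of y z x] by linarith
    also have "\<dots> \<le> (L + 1) * R" using \<open>R > 0\<close> by (simp add: algebra_simps)
    finally show "z \<in> ball y ((L + 1) * R)" by simp
  qed simp
  finally have le: "(\<Sum>x\<in>T. measure M (ball x (R / 2))) \<le> ?Y" .
  \<comment> \<open>No sign of \<open>C\<close> is assumed; growth between equal radii forces
    \<open>C \<ge> 1\<close>.\<close>
  have "N \<ge> 0"
  proof -
    have "measure M (ball y R) \<le> C * (R / R) powr Q * measure M (ball y R)"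
      using \<open>R > 0\<close> by (intro growth) auto
    then have "C \<ge> 1" using pos[OF \<open>R > 0\<close>, of y] \<open>R > 0\<close> by simp
    then show ?thesis by (simp add: N_def)
  qed
  have "real (card T) * ?Y \<le> (\<Sum>x\<in>T. N * measure M (ball x (R / 2)))"
    using sum_mono[of T "\<lambda>_. ?Y"] each by simp
  also have "\<dots> \<le> N * ?Y"
    using le \<open>N \<ge> 0\<close> by (simp flip: sum_distrib_left add: mult_left_mono)
  finally show ?thesis using Y by (simp add: T_def N_def)
qed

text \<open>The energy density at \<open>y\<close> does not depend on the set integrated over, so
  the sum multiplies it by the number of sets containing \<open>y\<close>. Only superadditivity and
  scaling of the lower integral are used.\<close>

lemma sum_KS_energy_le:
  assumes "finite S" "N > 0" and card: "\<And>y. real (card {x \<in> S. y \<in> B x}) \<le> N"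
  shows "(\<Sum>x\<in>S. KS_energy M dw (B x) f r) \<le> ennreal N * KS_energy M dw UNIV f r"
proof -
  let ?h = "\<lambda>x. 1 / emeasure M (ball x r) *
        (\<integral>\<^sup>+y\<in>ball x r. ennreal (\<bar>f y - f x\<bar>\<^sup>2 / r powr dw) \<partial>M)"
  have "(\<Sum>x\<in>S. KS_energy M dw (B x) f r) \<le> (\<integral>\<^sup>+y. (\<Sum>x\<in>S. ?h y * indicator (B x) y) \<partial>M)"
    unfolding KS_energy_def by (rule nn_integral_sum_le[OF \<open>finite S\<close>])
  also have "\<dots> \<le> (\<integral>\<^sup>+y. ennreal N * ?h y \<partial>M)"
  proof (rule nn_integral_mono)
    fix y
    have "(\<Sum>x\<in>S. ?h y * indicator (B x) y) = ?h y * of_nat (card {x \<in> S. y \<in> B x})"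
      using \<open>finite S\<close> by (simp add: indicator_def sum.If_cases Int_def flip: sum_distrib_left)
    also have "\<dots> \<le> ?h y * ennreal N"
      using card[of y] by (intro mult_left_mono) (auto simp: ennreal_of_nat_eq_real_of_nat intro: ennreal_leI)
    finally show "(\<Sum>x\<in>S. ?h y * indicator (B x) y) \<le> ennreal N * ?h y"
      by (simp only: mult.commute)
  qed
  also have "\<dots> \<le> ennreal N * (\<integral>\<^sup>+y. ?h y \<partial>M)"
    by (rule nn_integral_cmult_le[OF \<open>N > 0\<close>])
  finally show ?thesis by (simp add: KS_energy_def)
qed

lemma sum_Liminf_KS_energy_le:
  assumes "finite S" "N > 0" "\<And>y. real (card {x \<in> S. y \<in> B x}) \<le> N"
  shows "(\<Sum>x\<in>S. Liminf (at_right 0) (KS_energy M dw (B x) f))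
    \<le> ennreal N * Liminf (at_right 0) (KS_energy M dw UNIV f)"
proof -
  have "(\<Sum>x\<in>S. Liminf (at_right 0) (KS_energy M dw (B x) f))
      \<le> Liminf (at_right 0) (\<lambda>r. \<Sum>x\<in>S. KS_energy M dw (B x) f r)"
    by (rule Liminf_sum_le_ennreal) fact
  also have "\<dots> \<le> Liminf (at_right 0) (\<lambda>r. ennreal N * KS_energy M dw UNIV f r)"
    by (intro Liminf_mono always_eventually allI sum_KS_energy_le assms)
  also have "\<dots> = ennreal N * Liminf (at_right 0) (KS_energy M dw UNIV f)"
    by (rule Liminf_cmult_ennreal) simp
  finally show ?thesis .
qed

lemma Liminf_KS_energy_mono:
  assumes "A \<subseteq> B"
  shows "Liminf (at_right 0) (KS_energy M dw A f) \<le> Liminf (at_right 0) (KS_energy M dw B f)"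
  unfolding KS_energy_def using assms
  by (intro Liminf_mono always_eventually allI nn_integral_mono mult_left_mono) (auto simp: indicator_def)

text \<open>Averages \<open>f - c\<close> and bounds \<open>\<bar>t\<bar>\<close> by
  \<open>1 + t\<^sup>2\<close>, which explains the summand 1. The constant \<open>c\<close> is free:
  it is taken as the average over the doubled ball to compare scales, and as 0 to start the
  induction.\<close>

lemma abs_ball_average_diff_le:
  assumes "finite_measure M" "sets M = sets borel" "measure M (ball x R) > 0" "f \<in> Lp 2 M"
    and e: "(\<integral>\<^sup>+y\<in>ball x R. ennreal ((f y - c)\<^sup>2) \<partial>M) \<le> ennreal e" "e \<ge> 0"
  shows "\<bar>ball_average M f x R - c\<bar> \<le> 1 + e / measure M (ball x R)"
proof -
  interpret finite_measure M by fact
  have [measurable]: "f \<in> borel_measurable M" using assms(4) by (simp add: Lp_def)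
  have B[measurable]: "ball x R \<in> sets M" by (simp add: assms(2))
  let ?m = "measure M (ball x R)"
  have abs_le: "\<bar>t\<bar> \<le> 1 + t\<^sup>2" for t :: real
  proof -
    have "0 \<le> (\<bar>t\<bar> - 1)\<^sup>2" by simp
    also have "\<dots> = t\<^sup>2 - 2 * \<bar>t\<bar> + 1" by (simp add: power2_eq_square algebra_simps)
    finally show ?thesis by (smt (verit) zero_le_power2)
  qed
  have f2: "integrable M (\<lambda>y. (f y)\<^sup>2)"
    using assms(4) by (simp add: Lp_def)
  \<comment> \<open>On a finite measure space \<open>1 + f\<^sup>2\<close> is an integrable majorant
    of \<open>f\<close>.\<close>
  then have "integrable M (\<lambda>y. 1 + (f y)\<^sup>2)" by simp
  then have f1: "integrable M f"
    by (rule Bochner_Integration.integrable_bound) (use abs_le in \<open>auto intro!: AE_I2\<close>)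
  have "set_integrable M (ball x R) f"
    unfolding set_integrable_def using f1 by (intro integrable_mult_indicator B)
  moreover have "set_integrable M (ball x R) (\<lambda>_. c)"
    unfolding set_integrable_def by (intro integrable_mult_indicator B) simp
  ultimately have diff: "set_integrable M (ball x R) (\<lambda>y. f y - c)"
    and "(LINT y:ball x R|M. f y - c) = (LINT y:ball x R|M. f y) - ?m * c"
    by (auto simp: set_integral_diff set_integral_const)
  then have "ball_average M f x R - c = 1 / ?m * (LINT y:ball x R|M. f y - c)"
    using assms(3) by (simp add: ball_average_def field_simps)
  then have "\<bar>ball_average M f x R - c\<bar> = 1 / ?m * \<bar>LINT y:ball x R|M. f y - c\<bar>"
    by (simp add: abs_mult)
  also have "\<dots> \<le> 1 / ?m * (?m + e)"
  proof (intro mult_left_mono)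
    have "ennreal \<bar>LINT y:ball x R|M. f y - c\<bar> \<le> (\<integral>\<^sup>+y. ennreal (norm (indicator (ball x R) y *\<^sub>R (f y - c))) \<partial>M)"
      using integral_norm_bound_ennreal[OF diff[unfolded set_integrable_def]]
      by (simp add: set_lebesgue_integral_def)
    also have "\<dots> \<le> (\<integral>\<^sup>+y. indicator (ball x R) y + ennreal ((f y - c)\<^sup>2) * indicator (ball x R) y \<partial>M)"
      using ennreal_leI[OF abs_le] by (intro nn_integral_mono) (auto simp: indicator_def ennreal_plus)
    also have "\<dots> = ennreal ?m + (\<integral>\<^sup>+y\<in>ball x R. ennreal ((f y - c)\<^sup>2) \<partial>M)"
      by (subst nn_integral_add) (auto simp: emeasure_eq_measure)
    also have "\<dots> \<le> ennreal (?m + e)"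
      using e by (simp add: ennreal_plus add_left_mono)
    finally show "\<bar>LINT y:ball x R|M. f y - c\<bar> \<le> ?m + e"
      using e(2) by (simp only: ennreal_le_iff add_nonneg_nonneg measure_nonneg)
  qed simp
  also have "\<dots> = 1 + e / ?m" using assms(3) by (simp add: field_simps)
  finally show ?thesis .
qed

theorem theorem4p3:
  fixes \<mu> :: "'a::metric_space measure"
    and dw Q :: real
    and f :: "nat \<Rightarrow> 'a \<Rightarrow> real"
  assumes "dw > 2"
    and "compact (UNIV :: 'a set)"
    and "radon_measure \<mu>"
    and "positive_doubling \<mu>"
    and "0 < Q"
    and "volume_growth_exponent \<mu> Q"
    and "KS_Poincare \<mu> dw"
    and "Q \<le> dw"
    and "\<And>n. f n \<in> KS \<mu> dw"
    and "(SUP n. ennreal (Lp_norm 2 \<mu> (f n)) +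
            Liminf (at_right 0) (KS_energy \<mu> dw UNIV (f n))) < \<infinity>"
  shows "\<exists>(s :: nat \<Rightarrow> nat) (g :: 'a \<Rightarrow> real). strict_mono s \<and>
           (\<forall>\<alpha>\<ge>1. converges_in_Lp \<alpha> \<mu> (\<lambda>n. f (s n)) g)"
proof -

  \<comment> \<open>Finite measure, lower volume bound and uniform energy bound\<close>
  have sets: "sets \<mu> = sets borel" using assms(3) by (simp add: radon_measure_def)
  then have sp: "space \<mu> = UNIV" using sets_eq_imp_space_eq[OF sets] by simp
  have "emeasure \<mu> UNIV < \<infinity>" using assms(2,3) unfolding radon_measure_def by blast
  then have fm: "finite_measure \<mu>" by (intro finite_measureI) (simp add: sp)
  interpret finite_measure \<mu> by fact
  have pos: "measure \<mu> (ball x r) > 0" if "r > 0" for x r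
  proof -
    \<comment> \<open>The doubling condition states positivity for radius \<open>2 * r\<close>,
      hence the halving.\<close>
    have "emeasure \<mu> (ball x (2 * (r / 2))) > 0"
      using assms(4) that unfolding positive_doubling_def by (metis half_gt_zero)
    then show ?thesis by (simp add: emeasure_eq_measure)
  qed
  obtain C where "C > 0" and C: "\<And>x r R. 0 < r \<Longrightarrow> r \<le> R \<Longrightarrow>
      measure \<mu> (ball x R) / measure \<mu> (ball x r) \<le> C * (R / r) powr Q"
    using assms(6) by (auto simp: volume_growth_exponent_def)
  have growth: "measure \<mu> (ball x R) \<le> C * (R / r) powr Q * measure \<mu> (ball x r)"
    if "0 < r" "r \<le> R" for x r R
    using C[OF that, of x] pos[OF that(1), of x] by (simp add: field_simps)
  obtain D where "D > 0" and D: "\<And>x :: 'a. ball x D = UNIV"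
  proof
    \<comment> \<open>The summand 1 makes the open balls of radius \<open>D\<close> exhaust the
      space and keeps \<open>D\<close> positive for a single point.\<close>
    let ?D = "diameter (UNIV :: 'a set) + 1"
    have "bounded (UNIV :: 'a set)" using assms(2) by (rule compact_imp_bounded)
    note d = diameter_bounded_bound[OF this UNIV_I UNIV_I]
    show "?D > 0" using d[of undefined undefined] by simp
    show "ball x ?D = UNIV" for x :: 'a
    proof -
      have "dist x y < ?D" for y using d[of x y] by simp
      then show ?thesis by auto
    qed
  qed
  define V where "V = measure \<mu> UNIV"
  have "V > 0" using pos[OF \<open>D > 0\<close>] by (simp add: V_def D)
  define c where "c = V / (C * D powr dw)"
  have "c > 0" using \<open>V > 0\<close> \<open>C > 0\<close> \<open>D > 0\<close> by (simp add: c_def)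
  \<comment> \<open>Growth is compared with the full ball of radius \<open>D\<close>. Since
    \<open>D / R \<ge> 1\<close>, the exponent \<open>Q\<close> may be raised to \<open>dw\<close>;
    this is where \<open>Q \<le> dw\<close> enters.\<close>
  have lower: "c * R powr dw \<le> measure \<mu> (ball x R)" if "0 < R" "R \<le> D" for x R
  proof -
    have "V \<le> C * (D / R) powr Q * measure \<mu> (ball x R)"
      using growth[OF that, of x] by (simp add: V_def D)
    also have "\<dots> \<le> C * (D / R) powr dw * measure \<mu> (ball x R)"
      using that \<open>Q \<le> dw\<close> \<open>C > 0\<close> by (intro mult_right_mono mult_left_mono powr_mono) auto
    finally show ?thesis
      using that \<open>C > 0\<close> \<open>D > 0\<close> by (simp add: c_def powr_divide field_simps)
  qed
  obtain P L where "P > 0" "L \<ge> 1" and Poincare: "\<And>h x R. h \<in> KS \<mu> dw \<Longrightarrow> R > 0 \<Longrightarrow>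
      (\<integral>\<^sup>+y\<in>ball x R. ennreal ((h y - ball_average \<mu> h x R)\<^sup>2) \<partial>\<mu>)
        \<le> ennreal (P * R powr dw) * Liminf (at_right 0) (KS_energy \<mu> dw (ball x (L * R)) h)"
    using assms(7) by (auto simp: KS_Poincare_def)
  obtain E where "E \<ge> 0" and E: "(SUP n. ennreal (Lp_norm 2 \<mu> (f n)) +
            Liminf (at_right 0) (KS_energy \<mu> dw UNIV (f n))) = ennreal E"
    using assms(10) by (cases "SUP n. ennreal (Lp_norm 2 \<mu> (f n)) +
            Liminf (at_right 0) (KS_energy \<mu> dw UNIV (f n))") auto
  have sum_le: "ennreal (Lp_norm 2 \<mu> (f n)) + Liminf (at_right 0) (KS_energy \<mu> dw UNIV (f n)) \<le> ennreal E" for n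
    unfolding E[symmetric] by (rule SUP_upper) simp
  have energy: "Liminf (at_right 0) (KS_energy \<mu> dw UNIV (f n)) \<le> ennreal E" for n
    using sum_le[of n] by (rule order_trans[rotated]) simp
  have "ennreal (Lp_norm 2 \<mu> (f n)) \<le> ennreal E" for n
    using sum_le[of n] by (rule order_trans[rotated]) simp
  then have norm: "Lp_norm 2 \<mu> (f n) \<le> E" for n
    using \<open>E \<ge> 0\<close> by (simp add: ennreal_le_iff)
  have Lp: "f n \<in> Lp 2 \<mu>" for n using assms(9) by (simp add: KS_def)
  have meas: "f n \<in> borel_measurable \<mu>" for n using Lp by (simp add: Lp_def)
  have L2: "(\<integral>\<^sup>+y. ennreal ((f n y)\<^sup>2) \<partial>\<mu>) \<le> ennreal (E\<^sup>2)" for n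
  proof -
    have int: "integrable \<mu> (\<lambda>y. (f n y)\<^sup>2)" using Lp[of n] by (simp add: Lp_def)
    have "sqrt (\<integral>y. (f n y)\<^sup>2 \<partial>\<mu>) \<le> E"
      using norm[of n] by (simp add: Lp_norm_def powr_half_sqrt)
    then have "(\<integral>y. (f n y)\<^sup>2 \<partial>\<mu>) \<le> E\<^sup>2" by (rule sqrt_le_D)
    then show ?thesis
      by (subst nn_integral_eq_integral[OF int]) (auto intro: ennreal_leI)
  qed

  \<comment> \<open>Linear growth of the averages over shrinking balls\<close>
  define m where "m = 1 + P * 2 powr dw * E / c"
  define b where "b = 1 + E\<^sup>2 / V"
  have "m > 0" using \<open>P > 0\<close> \<open>E \<ge> 0\<close> \<open>c > 0\<close> by (auto simp: m_def intro!: add_pos_nonneg)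
  have "b \<ge> 0" using \<open>V > 0\<close> by (simp add: b_def)
  \<comment> \<open>(P) on the doubled ball controls \<open>f n\<close> minus the doubled average
    also on the smaller ball. The factor \<open>R powr dw\<close> cancels against the lower volume
    bound, so \<open>m\<close> is the same at every scale; \<open>b\<close> bounds the average over
    the whole space.\<close>
  have step: "\<bar>ball_average \<mu> (f n) x R - ball_average \<mu> (f n) x (2 * R)\<bar> \<le> m" if R: "0 < R" "R \<le> D" for n x R
  proof -
    let ?c = "ball_average \<mu> (f n) x (2 * R)"
    have "(\<integral>\<^sup>+y\<in>ball x R. ennreal ((f n y - ?c)\<^sup>2) \<partial>\<mu>) \<le> (\<integral>\<^sup>+y\<in>ball x (2 * R). ennreal ((f n y - ?c)\<^sup>2) \<partial>\<mu>)"
      using R by (intro nn_integral_mono) (auto simp: indicator_def)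
    also have "\<dots> \<le> ennreal (P * (2 * R) powr dw) * Liminf (at_right 0) (KS_energy \<mu> dw (ball x (L * (2 * R))) (f n))"
      using R by (intro Poincare assms) auto
    also have "\<dots> \<le> ennreal (P * (2 * R) powr dw) * ennreal E"
      by (intro mult_left_mono order_trans[OF Liminf_KS_energy_mono energy]) auto
    also have "\<dots> = ennreal (P * (2 * R) powr dw * E)"
      using \<open>P > 0\<close> \<open>E \<ge> 0\<close> by (simp add: ennreal_mult)
    finally have "\<bar>ball_average \<mu> (f n) x R - ?c\<bar> \<le> 1 + P * (2 * R) powr dw * E / measure \<mu> (ball x R)"
      using R \<open>P > 0\<close> \<open>E \<ge> 0\<close> by (intro abs_ball_average_diff_le fm sets Lp pos) auto
    also have "\<dots> \<le> 1 + P * (2 * R) powr dw * E / (c * R powr dw)"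
      using R \<open>P > 0\<close> \<open>E \<ge> 0\<close> \<open>c > 0\<close> pos[OF R(1), of x] lower[OF R, of x]
      by (intro add_left_mono divide_left_mono mult_pos_pos) auto
    also have "\<dots> = m" using R by (simp add: m_def powr_mult)
    finally show ?thesis .
  qed
  have averages: "\<bar>ball_average \<mu> (f n) x (D / 2 ^ k)\<bar> \<le> b + real k * m" for n x k
  proof (induction k)
    case 0
    have "\<bar>ball_average \<mu> (f n) x D - 0\<bar> \<le> 1 + E\<^sup>2 / measure \<mu> (ball x D)"
      using L2[of n] pos[OF \<open>D > 0\<close>] by (intro abs_ball_average_diff_le fm sets Lp) (auto simp: D)
    then show ?case by (simp add: b_def V_def D)
  next
    case (Suc k)
    have "(1 :: real) \<le> 2 ^ Suc k" by (rule one_le_power) simp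
    then have "D / 2 ^ Suc k \<le> D"
      using \<open>D > 0\<close> divide_left_mono[of 1 "2 ^ Suc k" D] by simp
    then have "\<bar>ball_average \<mu> (f n) x (D / 2 ^ Suc k) - ball_average \<mu> (f n) x (D / 2 ^ k)\<bar> \<le> m"
      using step[of "D / 2 ^ Suc k" n x] \<open>D > 0\<close> by simp
    then show ?case using Suc by (simp add: algebra_simps)
  qed

  \<comment> \<open>Coverings at scale \<open>k\<close> and geometric decay of the approximation
    error\<close>
  have "\<exists>S. finite S \<and> (\<forall>x\<in>S. \<forall>y\<in>S. x \<noteq> y \<longrightarrow> dist x y \<ge> D / 2 ^ k) \<and> (\<Union>x\<in>S. ball x (D / 2 ^ k)) = (UNIV :: 'a set)" for k :: nat
  proof -
    have "D / 2 ^ k > 0" using \<open>D > 0\<close> by simp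
    then show ?thesis by (rule compact_maximal_separated_set[OF assms(2)]) blast
  qed
  then obtain S :: "nat \<Rightarrow> 'a set" where fin: "\<And>k. finite (S k)"
    and sep: "\<And>k x y. x \<in> S k \<Longrightarrow> y \<in> S k \<Longrightarrow> x \<noteq> y \<Longrightarrow> dist x y \<ge> D / 2 ^ k"
    and cov: "\<And>k. (\<Union>x\<in>S k. ball x (D / 2 ^ k)) = UNIV"
    by metis
  \<comment> \<open>Overlap bound for the balls dilated by the factor \<open>L\<close> of (P); it is
    uniform in the scale, so the local energies sum to at most \<open>N\<close> times the total
    energy.\<close>
  define N where "N = C * (4 * L + 2) powr Q"
  have "N > 0" using \<open>C > 0\<close> \<open>L \<ge> 1\<close> by (simp add: N_def)
  have est: "(\<Sum>x\<in>S k. \<integral>\<^sup>+y\<in>ball x (D / 2 ^ k). ennreal ((f n y - ball_average \<mu> (f n) x (D / 2 ^ k))\<^sup>2) \<partial>\<mu>)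
      \<le> ennreal (P * D powr dw * N * E * exp (- (dw * ln 2) * real k))" for n k
  proof -
    let ?R = "D / 2 ^ k"
    have "?R > 0" using \<open>D > 0\<close> by simp
    have "(\<Sum>x\<in>S k. \<integral>\<^sup>+y\<in>ball x ?R. ennreal ((f n y - ball_average \<mu> (f n) x ?R)\<^sup>2) \<partial>\<mu>)
        \<le> (\<Sum>x\<in>S k. ennreal (P * ?R powr dw) * Liminf (at_right 0) (KS_energy \<mu> dw (ball x (L * ?R)) (f n)))"
      using \<open>?R > 0\<close> by (intro sum_mono Poincare assms) auto
    also have "\<dots> = ennreal (P * ?R powr dw) * (\<Sum>x\<in>S k. Liminf (at_right 0) (KS_energy \<mu> dw (ball x (L * ?R)) (f n)))"
      by (rule sum_distrib_left[symmetric])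
    also have "\<dots> \<le> ennreal (P * ?R powr dw) * (ennreal N * Liminf (at_right 0) (KS_energy \<mu> dw UNIV (f n)))"
      unfolding N_def using \<open>N > 0\<close> \<open>?R > 0\<close> \<open>L \<ge> 1\<close> sep
      by (intro mult_left_mono sum_Liminf_KS_energy_le fin separated_overlap_le[OF fm sets pos growth])
        (auto simp: N_def)
    also have "\<dots> \<le> ennreal (P * ?R powr dw) * (ennreal N * ennreal E)"
      by (intro mult_left_mono energy) auto
    also have "\<dots> = ennreal (P * ?R powr dw * (N * E))"
      using \<open>P > 0\<close> \<open>N > 0\<close> \<open>E \<ge> 0\<close> by (simp add: ennreal_mult)
    \<comment> \<open>Halving the radius multiplies \<open>R powr dw\<close> by a fixed factor below
      1; written as an exponential, this yields the decay rate \<open>dw * ln 2\<close>.\<close>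
    also have "?R powr dw = D powr dw * exp (- (dw * ln 2) * real k)"
    proof -
      have "(2 ^ k) powr dw = exp (dw * ln 2 * real k)"
        by (simp add: powr_def ln_realpow mult_ac)
      then show ?thesis using \<open>D > 0\<close> by (simp add: powr_divide exp_minus field_simps)
    qed
    finally show ?thesis by (simp add: mult_ac)
  qed
  show ?thesis
  proof (rule convergent_subsequence_of_approximate_averages[where B = "\<lambda>k x. ball x (D / 2 ^ k)"
        and I = S, OF fm meas _ fin _ est averages \<open>m > 0\<close> _ _ \<open>b \<ge> 0\<close>])
    show "0 < dw * ln 2" using \<open>dw > 2\<close> by simp
    show "0 \<le> P * D powr dw * N * E" using \<open>P > 0\<close> \<open>N > 0\<close> \<open>E \<ge> 0\<close> by simp
  qed (simp_all add: sets cov)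
qed

end
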